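(* Let $N=(P,T,\mathrm{Pre},\mathrm{Post},m_0)$ be a marked Petri net and let $p\in P$ be a redundant place of $N$. Let $N'$ be the net obtained from $N$ by removing place $p$ (i.e. with places $P\setminus\{p\}$, the same transitions, $\mathrm{Pre},\mathrm{Post}$ and $m_0$ restricted to $P\setminus\{p\}$). Then there are an integer constant $k\in\mathbb{N}\setminus\{0\}$ and a linear expression $\rho$ (with integer coefficients and constant term) in the markings of the places of $P\setminus\{p\}$ such that, for every marking $m:P\setminus\{p\}\to\mathbb{N}$, $$m\cup\{(p,(1/k)\cdot\rho(m))\}\in\mathcal{R}(N)\iff m\in\mathcal{R}(N').$$
   Context: A marked Petri net is a tuple $N=(P,T,\mathrm{Pre},\mathrm{Post},m_0)$ with $P,T$ disjoint finite sets, $\mathrm{Pre},\mathrm{Post}:T\to(P\to\mathbb{N})$, and $m_0:P\to\mathbb{N}$. A marking is a map from places to $\mathbb{N}$; a transition $t$ is enabled at $m$ if $m\ge\mathrm{Pre}(t)$ pointwise, and firing it yields $m-\mathrm{Pre}(t)+\mathrm{Post}(t)$. $\mathcal{R}(N)$ is the set of markings reachable from $m_0$ by finitely many firings. A marking over a set of places is written as a set of pairs (place, value), so $m\cup\{(p,x)\}$ extends $m$ by assigning $x$ to $p$. A place $p\in P$ is redundant if there exist a set $I\subseteq P\setminus\{p\}$, a valuation $v:I\cup\{p\}\to\mathbb{N}\setminus\{0\}$ and a constant $b\in\mathbb{N}$ such that: (1) $b=v(p)m_0(p)-\sum_{q\in I}v(q)m_0(q)$; (2) for every $t\in T$, $v(p)\mathrm{Pre}(t)(p)-\sum_{q\in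 I}v(q)\mathrm{Pre}(t)(q)\le b$; (3) for every $t\in T$, $v(p)(\mathrm{Post}(t)(p)-\mathrm{Pre}(t)(p))=\sum_{q\in I}v(q)(\mathrm{Post}(t)(q)-\mathrm{Pre}(t)(q))$. *)

theory Defs
  imports Complex_Main "HOL-Library.FuncSet"
begin

text \<open>Maps from a set of places to the naturals are extensional functions
  (\<open>P \<rightarrow>\<^sub>E UNIV\<close>), so that two markings over the same places are equal iff
  they agree on these places, and \<open>m(p := x)\<close> is \<open>m \<union> {(p, x)}\<close> when \<open>m\<close> is a
  marking over a set of places not containing \<open>p\<close>. Places and transitions share
  one type, and their disjointness is part of \<open>petri_net\<close>.\<close>

record 'a net =
  places :: "'a set"
  transitions :: "'a set"
  pre :: "'a \<Rightarrow> 'a \<Rightarrow> nat"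
  post :: "'a \<Rightarrow> 'a \<Rightarrow> nat"
  init :: "'a \<Rightarrow> nat"

definition markings :: "'a set \<Rightarrow> ('a \<Rightarrow> nat) set" where
  "markings P = P \<rightarrow>\<^sub>E UNIV"

definition petri_net :: "'a net \<Rightarrow> bool" where
  "petri_net N \<longleftrightarrow>
     finite (places N) \<and> finite (transitions N) \<and> places N \<inter> transitions N = {} \<and>
     pre N \<in> transitions N \<rightarrow>\<^sub>E markings (places N) \<and>
     post N \<in> transitions N \<rightarrow>\<^sub>E markings (places N) \<and>
     init N \<in> markings (places N)"

definition enabled :: "'a net \<Rightarrow> 'a \<Rightarrow> ('a \<Rightarrow> nat) \<Rightarrow> bool" where
  "enabled N t m \<longleftrightarrow> (\<forall>q\<in>places N. pre N t q \<le> m q)"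

text \<open>Only used for enabled transitions, so that the subtraction never truncates.\<close>

definition fire :: "'a net \<Rightarrow> 'a \<Rightarrow> ('a \<Rightarrow> nat) \<Rightarrow> ('a \<Rightarrow> nat)" where
  "fire N t m = (\<lambda>q\<in>places N. m q - pre N t q + post N t q)"

inductive_set reachable :: "'a net \<Rightarrow> ('a \<Rightarrow> nat) set" for N :: "'a net" where
  reachable_init: "init N \<in> reachable N"
| reachable_fire: "\<lbrakk>m \<in> reachable N; t \<in> transitions N; enabled N t m\<rbrakk>
    \<Longrightarrow> fire N t m \<in> reachable N"

definition redundant :: "'a net \<Rightarrow> 'a \<Rightarrow> bool" where
  "redundant N p \<longleftrightarrow> p \<in> places N \<and>
    (\<exists>I v (b::nat). I \<subseteq> places N - {p} \<and> v \<in> I \<union> {p} \<rightarrow>\<^sub>E (UNIV - {0::nat}) \<and>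
      int b = int (v p) * int (init N p) - (\<Sum>q\<in>I. int (v q) * int (init N q)) \<and>
      (\<forall>t\<in>transitions N.
         int (v p) * int (pre N t p) - (\<Sum>q\<in>I. int (v q) * int (pre N t q)) \<le> int b) \<and>
      (\<forall>t\<in>transitions N.
         int (v p) * (int (post N t p) - int (pre N t p)) =
           (\<Sum>q\<in>I. int (v q) * (int (post N t q) - int (pre N t q)))))"

definition remove_place :: "'a net \<Rightarrow> 'a \<Rightarrow> 'a net" where
  "remove_place N p =
     \<lparr>places = places N - {p},
      transitions = transitions N,
      pre = (\<lambda>t\<in>transitions N. restrict (pre N t) (places N - {p})),
      post = (\<lambda>t\<in>transitions N. restrict (post N t) (places N - {p})),
      init = restrict (init N) (places N - {p})\<rparr>"

definition linear_expression :: "'a set \<Rightarrow> (('a \<Rightarrow> nat) \<Rightarrow> int) \<Rightarrow> bool" where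
  "linear_expression Q \<rho> \<longleftrightarrow>
     (\<exists>(a :: 'a \<Rightarrow> int) (c :: int). \<forall>m. \<rho> m = c + (\<Sum>q\<in>Q. a q * int (m q)))"

lemma petri_net_remove_place: "petri_net N \<Longrightarrow> petri_net (remove_place N p)"
  by (auto simp: petri_net_def remove_place_def markings_def)

lemma reachable_markings:
  assumes "petri_net N" "m \<in> reachable N"
  shows "m \<in> markings (places N)"
  using assms(2) by cases (use assms(1) in \<open>auto simp: petri_net_def markings_def fire_def\<close>)

end

theory Submission
  imports Defs
begin

text \<open>The conditions on a redundant place \<open>p\<close> say that \<open>v(p) m(p) = b + (\<Sum>q\<in>I. v(q) m(q))\<close> holds
  initially and is preserved by every firing. Hence \<open>m(p)\<close> is determined by the other
  places, and whenever these enable a transition, the bound on \<open>Pre\<close> shows that \<open>p\<close>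
  cannot disable it. So removing \<open>p\<close> neither adds nor loses firing sequences.\<close>

lemma remove_place_simps [simp]:
  "places (remove_place N p) = places N - {p}"
  "transitions (remove_place N p) = transitions N"
  "init (remove_place N p) = restrict (init N) (places N - {p})"
  by (simp_all add: remove_place_def)

lemma enabled_remove_place:
  assumes "t \<in> transitions N"
  shows "enabled (remove_place N p) t m \<longleftrightarrow> (\<forall>q\<in>places N - {p}. pre N t q \<le> m q)"
  using assms by (simp add: enabled_def remove_place_def)

lemma fire_remove_place:
  assumes "t \<in> transitions N"
  shows "fire (remove_place N p) t m = (\<lambda>q\<in>places N - {p}. m q - pre N t q + post N t q)"
  using assms by (auto simp: fire_def remove_place_def)

text \<open>Firing acts on each place separately, so it commutes with forgetting \<open>p\<close>,
  and fewer places mean fewer conditions for enabling.\<close>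

lemma reachable_remove_place:
  assumes "m \<in> reachable N"
  shows "restrict m (places N - {p}) \<in> reachable (remove_place N p)"
  using assms
proof induction
  case reachable_init
  show ?case
    by (metis reachable.reachable_init remove_place_simps(3))
next
  case (reachable_fire m t)
  have "enabled (remove_place N p) t (restrict m (places N - {p}))"
    unfolding enabled_remove_place[OF reachable_fire.hyps(2)]
    using reachable_fire.hyps by (simp add: enabled_def)
  then have "fire (remove_place N p) t (restrict m (places N - {p})) \<in> reachable (remove_place N p)"
    by (rule reachable.reachable_fire[OF reachable_fire.IH, rotated])
      (use reachable_fire.hyps in simp)
  also have "fire (remove_place N p) t (restrict m (places N - {p}))
      = restrict (fire N t m) (places N - {p})"
    unfolding fire_remove_place[OF reachable_fire.hyps(2)] by (auto simp: fire_def)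
  finally show ?case .
qed

text \<open>Enabledness keeps the natural subtraction in \<open>fire\<close> from truncating, so the
  marking equation holds over the integers place by place.\<close>

lemma weighted_sum_fire:
  fixes v :: "'a \<Rightarrow> nat"
  assumes "enabled N t m" "I \<subseteq> places N"
  shows "(\<Sum>q\<in>I. int (v q) * int (fire N t m q)) =
    (\<Sum>q\<in>I. int (v q) * int (m q)) + (\<Sum>q\<in>I. int (v q) * (int (post N t q) - int (pre N t q)))"
proof -
  have "int (v q) * int (fire N t m q)
      = int (v q) * int (m q) + int (v q) * (int (post N t q) - int (pre N t q))" if "q \<in> I" for q
  proof -
    have q: "q \<in> places N" "pre N t q \<le> m q"
      using assms that by (auto simp: enabled_def)
    then have "int (fire N t m q) = int (m q) + (int (post N t q) - int (pre N t q))"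
      by (simp add: fire_def)
    then show ?thesis by (simp only: distrib_left)
  qed
  then show ?thesis
    by (simp flip: sum.distrib)
qed

text \<open>This is a place invariant: \<open>init\<close> fixes its constant at the initial
  marking, and by \<open>effect\<close> each firing changes both sides equally.\<close>

lemma reachable_weighted_sum:
  fixes v :: "'a \<Rightarrow> nat" and b :: int
  assumes m: "m \<in> reachable N"
    and I: "p \<in> places N" "I \<subseteq> places N"
    and init: "b = int (v p) * int (init N p) - (\<Sum>q\<in>I. int (v q) * int (init N q))"
    and effect: "\<And>t. t \<in> transitions N \<Longrightarrow>
      int (v p) * (int (post N t p) - int (pre N t p)) =
        (\<Sum>q\<in>I. int (v q) * (int (post N t q) - int (pre N t q)))"
  shows "int (v p) * int (m p) = b + (\<Sum>q\<in>I. int (v q) * int (m q))"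
  using m
proof induction
  case reachable_init
  show ?case using init by simp
next
  case (reachable_fire m t)
  \<comment> \<open>The instance \<open>{p}\<close> gives the change of the left side, the instance
    \<open>I\<close> that of the right.\<close>
  then show ?case
    using weighted_sum_fire[of N t m I v] weighted_sum_fire[of N t m "{p}" v] effect I by simp
qed

text \<open>A firing sequence of the smaller net is replayed in \<open>N\<close>. The invariant ties
  the value at \<open>p\<close> to the places of \<open>I\<close>, and \<open>guard\<close> turns
  this into enough tokens on \<open>p\<close> for each transition.\<close>

lemma reachable_remove_place_extend:
  fixes v :: "'a \<Rightarrow> nat" and b :: int
  assumes m: "m \<in> reachable (remove_place N p)"
    and N: "petri_net N"
    and I: "p \<in> places N" "I \<subseteq> places N - {p}" and vp: "v p \<noteq> 0"
    and init: "b = int (v p) * int (init N p) - (\<Sum>q\<in>I. int (v q) * int (init N q))"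
    and guard: "\<And>t. t \<in> transitions N \<Longrightarrow>
      int (v p) * int (pre N t p) - (\<Sum>q\<in>I. int (v q) * int (pre N t q)) \<le> b"
    and effect: "\<And>t. t \<in> transitions N \<Longrightarrow>
      int (v p) * (int (post N t p) - int (pre N t p)) =
        (\<Sum>q\<in>I. int (v q) * (int (post N t q) - int (pre N t q)))"
  shows "\<exists>x. m(p := x) \<in> reachable N"
  using m
proof induction
  case reachable_init
  \<comment> \<open>Outside \<open>places N\<close> both sides are \<open>undefined\<close>, since
    \<open>init N\<close> is extensional.\<close>
  have "(init (remove_place N p))(p := init N p) = init N"
    using N I by (auto simp: petri_net_def markings_def PiE_def extensional_def restrict_def)
  then show ?case
    using reachable.reachable_init[of N] by metis
next
  case (reachable_fire m t)
  then obtain x where x: "m(p := x) \<in> reachable N" by blast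
  have t: "t \<in> transitions N" using reachable_fire.hyps by simp
  have en: "\<forall>q\<in>places N - {p}. pre N t q \<le> m q"
    using reachable_fire.hyps t by (simp add: enabled_remove_place)
  have sum_upd: "(\<Sum>q\<in>I. int (v q) * int ((m(p := x)) q)) = (\<Sum>q\<in>I. int (v q) * int (m q))"
    using I by (intro sum.cong) auto
  \<comment> \<open>The chain compares the demand of \<open>t\<close> on \<open>p\<close> with its
    demand on \<open>I\<close>, then with the tokens on \<open>I\<close>, then by the invariant with
    those on \<open>p\<close>; the positive factor \<open>v p\<close> cancels.\<close>
  have "int (v p) * int (pre N t p) \<le> b + (\<Sum>q\<in>I. int (v q) * int (pre N t q))"
    using guard[OF t] by simp
  also have "\<dots> \<le> b + (\<Sum>q\<in>I. int (v q) * int (m q))"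
    using en I by (intro add_left_mono sum_mono mult_left_mono) auto
  also have "\<dots> = int (v p) * int x"
    using reachable_weighted_sum[OF x \<open>p \<in> places N\<close> _ init effect] I sum_upd
    by (simp add: subset_Diff_insert)
  finally have "pre N t p \<le> x"
    using vp by simp
  then have "enabled N t (m(p := x))"
    using en by (simp add: enabled_def)
  then have "fire N t (m(p := x)) \<in> reachable N"
    using x t by (intro reachable.reachable_fire)
  also have "fire N t (m(p := x))
      = (fire (remove_place N p) t m)(p := x - pre N t p + post N t p)"
    unfolding fire_remove_place[OF t] using I by (auto simp: fire_def)
  finally show ?case by blast
qed

theorem theorem2:
  fixes N :: "'a net" and p :: 'a
  assumes "petri_net N"
    and "p \<in> places N"
    and "redundant N p"
  shows "\<exists>(k::nat) (\<rho> :: ('a \<Rightarrow> nat) \<Rightarrow> int).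
    k \<noteq> 0 \<and> linear_expression (places N - {p}) \<rho> \<and>
    (\<forall>m \<in> markings (places N - {p}).
      (\<exists>x::nat. (of_nat x :: rat) = (1 / of_nat k) * of_int (\<rho> m) \<and> m(p := x) \<in> reachable N)
      \<longleftrightarrow> m \<in> reachable (remove_place N p))"
proof -
  from assms(3) obtain I and v :: "'a \<Rightarrow> nat" and b :: nat where
    I: "I \<subseteq> places N - {p}" and v: "v \<in> I \<union> {p} \<rightarrow>\<^sub>E (UNIV - {0})" and
    init: "int b = int (v p) * int (init N p) - (\<Sum>q\<in>I. int (v q) * int (init N q))" and
    guard: "\<And>t. t \<in> transitions N \<Longrightarrow>
      int (v p) * int (pre N t p) - (\<Sum>q\<in>I. int (v q) * int (pre N t q)) \<le> int b" and
    effect: "\<And>t. t \<in> transitions N \<Longrightarrow>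
      int (v p) * (int (post N t p) - int (pre N t p)) =
        (\<Sum>q\<in>I. int (v q) * (int (post N t q) - int (pre N t q)))"
    unfolding redundant_def by blast
  have vp: "v p \<noteq> 0" using v by auto
  \<comment> \<open>With \<open>k = v p\<close>, the invariant solved for the marking of
    \<open>p\<close> gives \<rho> divided by \<open>k\<close>.\<close>
  define \<rho> where "\<rho> m = int b + (\<Sum>q\<in>I. int (v q) * int (m q))" for m :: "'a \<Rightarrow> nat"
  have "finite (places N - {p})"
    using assms(1) by (simp add: petri_net_def)
  \<comment> \<open>Places outside \<open>I\<close> get coefficient 0, so that the sum ranges over
    all remaining places.\<close>
  then have "(\<Sum>q\<in>I. int (v q) * int (m q))
      = (\<Sum>q\<in>places N - {p}. (if q \<in> I then int (v q) else 0) * int (m q))" for m :: "'a \<Rightarrow> nat"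
    using I by (intro sum.mono_neutral_cong_left) auto
  then have linear: "linear_expression (places N - {p}) \<rho>"
    unfolding linear_expression_def \<rho>_def by (intro exI allI) (rule arg_cong)
  \<comment> \<open>Every reachable extension of \<open>m\<close> has the prescribed value at
    \<open>p\<close>, so any witness of reachability also satisfies the equation in the
    claim.\<close>
  have invariant: "(of_nat x :: rat) = (1 / of_nat (v p)) * of_int (\<rho> m)"
    if "m(p := x) \<in> reachable N" for m x
  proof -
    have "(\<Sum>q\<in>I. int (v q) * int ((m(p := x)) q)) = (\<Sum>q\<in>I. int (v q) * int (m q))"
      using I by (intro sum.cong) auto
    then have "\<rho> m = int (v p) * int x"
      using reachable_weighted_sum[OF that assms(2) _ init effect] I
      by (simp add: \<rho>_def subset_Diff_insert)
    then show ?thesis using vp by simp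
  qed
  have "(\<exists>x::nat. (of_nat x :: rat) = (1 / of_nat (v p)) * of_int (\<rho> m) \<and> m(p := x) \<in> reachable N)
      \<longleftrightarrow> m \<in> reachable (remove_place N p)" (is "?L \<longleftrightarrow> ?R")
    if m: "m \<in> markings (places N - {p})" for m
  proof
    assume ?L
    then obtain x where "m(p := x) \<in> reachable N" by blast
    then have "restrict (m(p := x)) (places N - {p}) \<in> reachable (remove_place N p)"
      by (rule reachable_remove_place)
    \<comment> \<open>As a marking of the smaller net, \<open>m\<close> is \<open>undefined\<close>
      at \<open>p\<close>, which is what the restriction restores.\<close>
    also have "restrict (m(p := x)) (places N - {p}) = m"
      using m by (auto simp: markings_def PiE_def extensional_def restrict_def)
    finally show ?R .
  next
    assume ?R
    then obtain x where "m(p := x) \<in> reachable N"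
      using reachable_remove_place_extend[OF _ assms(1,2) I vp init guard effect] by blast
    with invariant show ?L by blast
  qed
  with vp linear show ?thesis by blast
qed

end
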